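(* Let $\alpha\in(0,1)$ and $T>0$. Consider the explicit solution $\{w_\alpha,r_\alpha\}$ of problem (P1), $$w_\alpha(x,t)=1-\frac{1-W\left(-\frac{x}{t^{\alpha/2}},-\frac{\alpha}{2},1\right)}{1-W\left(-2\eta_\alpha,-\frac{\alpha}{2},1\right)},\qquad r_\alpha(t)=2\eta_\alpha t^{\alpha/2},$$ where $\eta_\alpha$ is the unique solution of $$2x\left[1-W\left(-2x,-\tfrac{\alpha}{2},1\right)\right]=M_{\alpha/2}(2x)\,\frac{\Gamma(1-\alpha/2)}{\Gamma(1+\alpha/2)},\qquad x>0,$$ and the explicit solution $\{u_\alpha,s_\alpha\}$ of problem (P2), $$u_\alpha(x,t)=1-\frac{1-W\left(-\frac{x}{t^{\alpha/2}},-\frac{\alpha}{2},1\right)}{1-W\left(-2\xi_\alpha,-\frac{\alpha}{2},1\right)},\qquad s_\alpha(t)=2\xi_\alpha t^{\alpha/2},$$ where $\xi_\alpha$ is the unique solution of $$2x\left[1-W\left(-2x,-\tfrac{\alpha}{2},1\right)\right]=2x\,W\left(-2x,-\tfrac{\alpha}{2},1\right)+W\left(-2x,-\tfrac{\alpha}{2},1+\tfrac{\alpha}{2}\right),\qquad x>0.$$ Then the two solutions $\{w_\alpha,r_\alpha\}$ and $\{u_\alpha,s_\alpha\}$ are different. (The problems (P1), (P2) and the functions $W$, $M_{\alpha/2}$ are defined in the context.)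
   Context: $\Gamma$ is the Gamma function, and $1/\Gamma$ is taken to be $0$ at the poles of $\Gamma$. The Wright function is $W(x,\rho,\beta)=\sum_{k=0}^{\infty}\frac{x^k}{k!\,\Gamma(\rho k+\beta)}$ for $x\in\mathbb{R}$, $\rho>-1$, $\beta\in\mathbb{R}$. The Mainardi function is $M_\rho(x)=W(-x,-\rho,1-\rho)$ for $0<\rho<1$. For $\alpha\in(0,1)$, the Caputo derivative in time is ${}^{C}_{0}D^{\alpha}_t f(t)=\frac{1}{\Gamma(1-\alpha)}\int_0^t\frac{f'(\tau)}{(t-\tau)^{\alpha}}\,d\tau$, and the Riemann–Liouville derivative of order $1-\alpha$ is ${}^{RL}_{0}D^{1-\alpha}_t f(t)=\frac{1}{\Gamma(\alpha)}\frac{d}{dt}\int_0^t\frac{f(\tau)}{(t-\tau)^{1-\alpha}}\,d\tau$. For functions of $(x,t)$ these act in the variable $t$ with $x$ fixed. Problem (P1), with unknowns $u(x,t)$ and $s(t)$: ${}^{C}_{0}D^{\alpha}_t u=\frac{\partial^2 u}{\partial x^2}$ for $0<x<s(t)$, $0<t<T$; $s(0)=0$; $u(0,t)=1$ for $0<t\le T$; $u(s(t),t)=0$ for $0<t\le T$; ${}^{C}_{0}D^{\alpha}_t s(t)=-u_x(s(t),t)$ for $0<t\le T$. Problem (P2), with unknowns $u(x,t)$ and $s(t)$: $\frac{\partial u}{\partial t}=\frac{\partial}{\partial x}\left({}^{RL}_{0}D^{1-\alpha}_t\frac{\partial u}{\partial x}\right)$ for $0<x<s(t)$, $0<t<T$;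 $s(0)=0$; $u(0,t)=1$ for $0<t\le T$; $u(s(t),t)=0$ for $0<t\le T$; $s'(t)=-\lim_{x\to s(t)}{}^{RL}_{0}D^{1-\alpha}_t\frac{\partial u}{\partial x}(x,t)$ for $0<t\le T$. It is known from earlier work that the equations for $\eta_\alpha$ and $\xi_\alpha$ each have exactly one positive solution, that $\{w_\alpha,r_\alpha\}$ solves (P1) and that $\{u_\alpha,s_\alpha\}$ solves (P2). *)

theory Defs
  imports "HOL-Analysis.Analysis"
begin

(* rGamma is the reciprocal Gamma function, which vanishes at the poles of Gamma. *)
definition wright :: "real \<Rightarrow> real \<Rightarrow> real \<Rightarrow> real" where
  "wright x \<rho> \<beta> = (\<Sum>k. x ^ k / fact k * rGamma (\<rho> * real k + \<beta>))"

definition mainardi :: "real \<Rightarrow> real \<Rightarrow> real" where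
  "mainardi \<rho> x = wright (- x) (- \<rho>) (1 - \<rho>)"

(* The fractional derivatives are relations, "the derivative exists and equals D", so that no
   junk value of a divergent integral or of a non-existing derivative can satisfy an equation. *)

definition has_caputo_derivative :: "real \<Rightarrow> (real \<Rightarrow> real) \<Rightarrow> real \<Rightarrow> real \<Rightarrow> bool" where
  "has_caputo_derivative \<alpha> f t D \<longleftrightarrow>
     (\<forall>\<tau>\<in>{0<..<t}. f differentiable (at \<tau>)) \<and>
     (\<lambda>\<tau>. deriv f \<tau> / (t - \<tau>) powr \<alpha>) absolutely_integrable_on {0<..<t} \<and>
     D = 1 / Gamma (1 - \<alpha>) * integral {0<..<t} (\<lambda>\<tau>. deriv f \<tau> / (t - \<tau>) powr \<alpha>)"

(* Riemann-Liouville derivative of order \<gamma> of a function on {0<..T}; at t = T the outer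
   derivative is one-sided.  For \<gamma> = 1 - \<alpha> the prefactor is 1 / Gamma \<alpha>. *)
definition has_rl_derivative ::
    "real \<Rightarrow> real \<Rightarrow> (real \<Rightarrow> real) \<Rightarrow> real \<Rightarrow> real \<Rightarrow> bool" where
  "has_rl_derivative T \<gamma> f t D \<longleftrightarrow>
     (\<forall>t'\<in>{0<..T}. (\<lambda>\<tau>. f \<tau> / (t' - \<tau>) powr \<gamma>) absolutely_integrable_on {0<..<t'}) \<and>
     ((\<lambda>t'. 1 / Gamma (1 - \<gamma>) * integral {0<..<t'} (\<lambda>\<tau>. f \<tau> / (t' - \<tau>) powr \<gamma>))
        has_real_derivative D) (at t within {0<..T})"

(* In both problems u is taken to be defined for all x and t, also beyond the free boundary:
   the fractional derivatives at (x, t) involve u x \<tau> for every \<tau> in (0, t), even when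
   s \<tau> \<le> x. *)

definition boundary_conditions ::
    "real \<Rightarrow> (real \<Rightarrow> real \<Rightarrow> real) \<Rightarrow> (real \<Rightarrow> real) \<Rightarrow> bool" where
  "boundary_conditions T u s \<longleftrightarrow>
     s 0 = 0 \<and> (\<forall>t\<in>{0<..T}. 0 < s t \<and> u 0 t = 1 \<and> u (s t) t = 0)"

definition solves_P1 ::
    "real \<Rightarrow> real \<Rightarrow> (real \<Rightarrow> real \<Rightarrow> real) \<Rightarrow> (real \<Rightarrow> real) \<Rightarrow> bool" where
  "solves_P1 \<alpha> T u s \<longleftrightarrow>
     boundary_conditions T u s \<and>
     (\<forall>t\<in>{0<..<T}. \<forall>x\<in>{0<..<s t}. \<exists>ux uxx.
        (\<forall>\<^sub>F y in nhds x. ((\<lambda>z. u z t) has_real_derivative ux y) (at y)) \<and>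
        (ux has_real_derivative uxx) (at x) \<and>
        has_caputo_derivative \<alpha> (\<lambda>\<tau>. u x \<tau>) t uxx) \<and>
     (\<forall>t\<in>{0<..T}. \<exists>ux.
        ((\<lambda>x. u x t) has_real_derivative ux) (at (s t) within {0..s t}) \<and>
        has_caputo_derivative \<alpha> s t (- ux))"

(* q x t is the Riemann-Liouville derivative of order 1 - \<alpha> of ux x at time t. *)
definition solves_P2 ::
    "real \<Rightarrow> real \<Rightarrow> (real \<Rightarrow> real \<Rightarrow> real) \<Rightarrow> (real \<Rightarrow> real) \<Rightarrow> bool" where
  "solves_P2 \<alpha> T u s \<longleftrightarrow>
     boundary_conditions T u s \<and>
     (\<exists>ux q.
        (\<forall>t\<in>{0<..T}. \<forall>x\<in>{0<..<s t}.
           (\<forall>\<tau>\<in>{0<..T}. ((\<lambda>y. u y \<tau>) has_real_derivative ux x \<tau>) (at x)) \<and>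
           has_rl_derivative T (1 - \<alpha>) (\<lambda>\<tau>. ux x \<tau>) t (q x t)) \<and>
        (\<forall>t\<in>{0<..<T}. \<forall>x\<in>{0<..<s t}. \<exists>d.
           ((\<lambda>\<tau>. u x \<tau>) has_real_derivative d) (at t) \<and>
           ((\<lambda>y. q y t) has_real_derivative d) (at x)) \<and>
        (\<forall>t\<in>{0<..T}. \<exists>l.
           ((\<lambda>x. q x t) \<longlongrightarrow> l) (at_left (s t)) \<and>
           (s has_real_derivative - l) (at t within {0..T})))"

(* The explicit solutions of both problems have this form and differ only in the constant c. *)

definition temperature :: "real \<Rightarrow> real \<Rightarrow> real \<Rightarrow> real \<Rightarrow> real" where
  "temperature \<alpha> c x t =
     1 - (1 - wright (- (x / t powr (\<alpha> / 2))) (- (\<alpha> / 2)) 1)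
         / (1 - wright (- (2 * c)) (- (\<alpha> / 2)) 1)"

definition front :: "real \<Rightarrow> real \<Rightarrow> real \<Rightarrow> real" where
  "front \<alpha> c t = 2 * c * t powr (\<alpha> / 2)"

definition eta_equation :: "real \<Rightarrow> real \<Rightarrow> bool" where
  "eta_equation \<alpha> x \<longleftrightarrow>
     2 * x * (1 - wright (- (2 * x)) (- (\<alpha> / 2)) 1) =
     mainardi (\<alpha> / 2) (2 * x) * (Gamma (1 - \<alpha> / 2) / Gamma (1 + \<alpha> / 2))"

definition xi_equation :: "real \<Rightarrow> real \<Rightarrow> bool" where
  "xi_equation \<alpha> x \<longleftrightarrow>
     2 * x * (1 - wright (- (2 * x)) (- (\<alpha> / 2)) 1) =
     2 * x * wright (- (2 * x)) (- (\<alpha> / 2)) 1 + wright (- (2 * x)) (- (\<alpha> / 2)) (1 + \<alpha> / 2)"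

(* Equality of solutions: equal free boundaries, and equal temperatures on the common domain;
   values of u outside the domain are disregarded. *)
definition same_solution ::
    "real \<Rightarrow> (real \<Rightarrow> real \<Rightarrow> real) \<times> (real \<Rightarrow> real) \<Rightarrow>
      (real \<Rightarrow> real \<Rightarrow> real) \<times> (real \<Rightarrow> real) \<Rightarrow> bool" where
  "same_solution T = (\<lambda>(w, r) (u, s).
     (\<forall>t\<in>{0..T}. r t = s t) \<and>
     (\<forall>t\<in>{0<..T}. \<forall>x\<in>{0..r t}. w x t = u x t))"

end

theory Submission
  imports Defs "HOL-Real_Asymp.Real_Asymp"
begin

text \<open>
  Put \<open>a = \<alpha> / 2\<close>, \<open>W\<^sub>\<beta> x = W(-x, -a, \<beta>)\<close> and \<open>M = W\<^sub>1\<^sub>-\<^sub>a\<close>.  If the solutions coincide, then \<open>\<eta> = \<xi>\<close>, and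
  \<open>x = 2 \<eta>\<close> satisfies \<open>x (1 - W\<^sub>1 x) = \<kappa> M x = W\<^sub>a x / a\<close> with \<open>\<kappa> = \<Gamma>(1 - a) / \<Gamma>(1 + a)\<close>.  The function
  \<open>D = W\<^sub>a - a \<kappa> M\<close> is the Riemann-Liouville derivative of order \<open>1 - 2 a\<close> at \<open>\<tau> = 1\<close> of
  \<open>\<tau>\<^sup>-\<^sup>a (M(x \<tau>\<^sup>-\<^sup>a) - M x)\<close>.  This function of \<open>\<tau>\<close> has a maximum at \<open>\<tau> = 1\<close>, because \<open>M\<close> is decreasing, so the
  extremum principle gives \<open>D x \<ge> c (M x - M(2\<^sup>a x)) \<ge> 0\<close> with \<open>c > 0\<close>.  If \<open>D x = 0\<close>, then \<open>M\<close> is constant on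
  \<open>[x, 2\<^sup>a x]\<close> and \<open>D\<close> is minimal at \<open>x\<close>; as \<open>D' x = - a x M x + a \<kappa> W\<^sub>1\<^sub>-\<^sub>2\<^sub>a x\<close>, this forces \<open>M x = 0\<close>, hence
  \<open>W\<^sub>1 x = 1 = W\<^sub>1 0\<close>, which contradicts \<open>W\<^sub>1' = - M \<le> 0\<close> and \<open>M 0 > 0\<close>.

  Positivity and the extremum principle are proved for a discretisation in the manner of Gruenwald
  and Letnikov: \<open>W\<^sub>\<beta> x\<close> is the limit of \<open>m\<^sup>1\<^sup>-\<^sup>\<beta>\<close> times the coefficient of \<open>z\<^sup>m\<close> in
  \<open>(1 - z)\<^sup>-\<^sup>\<beta> exp (- y (1 - z)\<^sup>a)\<close> at \<open>y = x m\<^sup>a\<close>.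
\<close>

subsection \<open>Coefficients of binomial series\<close>

text \<open>\<open>negbin b m\<close> is the coefficient of \<open>z\<^sup>m\<close> in \<open>(1 - z)\<^sup>-\<^sup>b\<close>.\<close>

definition negbin :: "real \<Rightarrow> nat \<Rightarrow> real" where
  "negbin b m = pochhammer b m / fact m"

lemma negbin_0 [simp]: "negbin b 0 = 1"
  by (simp add: negbin_def)

lemma negbin_Suc: "negbin b (Suc m) = negbin b m * ((b + real m) / real (Suc m))"
  by (simp add: negbin_def pochhammer_Suc)

lemma negbin_Suc_shift: "real (Suc m) * negbin b (Suc m) = b * negbin (b + 1) m"
  by (simp add: negbin_def pochhammer_rec field_simps del: of_nat_Suc)

lemma negbin_nonneg: "0 \<le> b \<Longrightarrow> 0 \<le> negbin b m"
  by (induction m) (simp_all add: negbin_Suc)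

lemma negbin_pos: "0 < b \<Longrightarrow> 0 < negbin b m"
  by (simp add: negbin_def pochhammer_pos)

text \<open>Cauchy product of \<open>(1 - z)^(-b)\<close> and \<open>(1 - z)^(-c)\<close>; in
  Pochhammer form it is Vandermonde's identity.\<close>

lemma negbin_add: "negbin (b + c) m = (\<Sum>k\<le>m. negbin b k * negbin c (m - k))"
  unfolding negbin_def pochhammer_binomial_sum sum_divide_distrib
  by (rule sum.cong) (auto simp: binomial_fact)

lemma negbin_1 [simp]: "negbin 1 m = 1"
  by (simp add: negbin_def pochhammer_fact [symmetric])

lemma sum_negbin: "(\<Sum>k\<le>m. negbin b k) = negbin (b + 1) m"
  by (simp add: negbin_add)

text \<open>The Pochhammer symbol in \<open>rGamma_series b m\<close> has one further factor
  \<open>b + m\<close>; the quotient \<open>m / (b + m)\<close> cancels it and supplies the missing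
  power of \<open>m\<close>.\<close>

lemma negbin_tendsto: "(\<lambda>m. real m powr (1 - b) * negbin b m) \<longlonglongrightarrow> rGamma b"
proof (rule Lim_transform_eventually)
  show "(\<lambda>m. rGamma_series b m * (real m / (b + real m))) \<longlonglongrightarrow> rGamma b"
  proof -
    have "(\<lambda>m. real m / (b + real m)) \<longlonglongrightarrow> 1"
      by real_asymp
    from tendsto_mult [OF rGamma_series_LIMSEQ this] show ?thesis
      by simp
  qed
  obtain N where N: "\<bar>b\<bar> < real N"
    using reals_Archimedean2 by blast
  show "\<forall>\<^sub>F m in sequentially. rGamma_series b m * (real m / (b + real m)) = real m powr (1 - b) * negbin b m"
    using eventually_gt_at_top [of N]
  proof eventually_elim
    case (elim m)
    then have "real m > 0" "b + real m \<noteq> 0" using N by auto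
    then show ?case
      by (simp add: rGamma_series_def negbin_def pochhammer_Suc powr_def exp_diff left_diff_distrib ac_simps)
  qed
qed

text \<open>A majorant of \<open>m^(1 - b) |negbin b m|\<close> for \<open>d = |1 - b|\<close>,
  uniform in \<open>m > 0\<close>. It grows roughly like \<open>d^(2 d)\<close>, so for
  \<open>d = c + a j\<close> with \<open>2 a < 1\<close> it is still beaten by
  \<open>j!\<close>.\<close>

definition growth :: "real \<Rightarrow> real" where
  "growth d = exp (2 * d * (1 + ln (d + 2)))"

lemma growth_mono: "0 \<le> d \<Longrightarrow> d \<le> e \<Longrightarrow> growth d \<le> growth e"
  unfolding growth_def by (intro exp_le_cancel_iff [THEN iffD2] mult_mono) auto

lemma harm_le_ln: "0 < n \<Longrightarrow> harm n \<le> 1 + ln (real n)"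
  using euler_mascheroni_sequence_decreasing [of 1 n] by (simp add: harm_expand)

text \<open>Each factor \<open>1 - (1 - b) / (i + 1)\<close> of \<open>negbin b m\<close> has
  modulus at most \<open>exp (|1 - b| / (i + 1))\<close>; the exponents add up to a harmonic
  number.\<close>

lemma abs_negbin_le:
  "\<bar>negbin b m\<bar> \<le> exp (\<bar>1 - b\<bar> * harm m)"
proof (induction m)
  case (Suc m)
  have "(b + real m) / real (Suc m) = 1 - (1 - b) / real (Suc m)"
    by (simp add: field_simps)
  then have "\<bar>(b + real m) / real (Suc m)\<bar> \<le> 1 + \<bar>1 - b\<bar> / real (Suc m)"
    by (metis abs_divide abs_of_nat abs_one abs_triangle_ineq4)
  also have "\<dots> \<le> exp (\<bar>1 - b\<bar> / real (Suc m))"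
    by (rule exp_ge_add_one_self)
  finally show ?case
    using Suc by (simp add: negbin_Suc abs_mult harm_Suc distrib_left exp_add mult_mono divide_inverse)
qed (simp add: harm_expand)

text \<open>From index \<open>k\<close> on, the factors \<open>1 - (1 - b) / (i + 1)\<close> are
  nonnegative, so the exponential bound keeps its negative exponent and yields decay. The first
  \<open>k\<close> factors are bounded crudely by \<open>abs_negbin_le\<close>, whence
  \<open>2 * harm k\<close>.\<close>

lemma abs_negbin_le_decay:
  assumes "1 - b \<le> real k" "k \<le> m" "b \<le> 1"
  shows "\<bar>negbin b m\<bar> \<le> exp ((1 - b) * (2 * harm k - harm m))"
  using assms(2)
proof (induction m rule: dec_induct)
  case base
  show ?case using abs_negbin_le [of b k] assms(3) by simp
next
  case (step m)
  have eq: "(b + real m) / real (Suc m) = 1 - (1 - b) / real (Suc m)"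
    by (simp add: field_simps)
  have "\<bar>(b + real m) / real (Suc m)\<bar> = 1 + (- ((1 - b) / real (Suc m)))"
    using assms step by (subst abs_of_nonneg) (auto intro!: divide_nonneg_nonneg simp: field_simps)
  also have "\<dots> \<le> exp (- ((1 - b) / real (Suc m)))"
    by (rule exp_ge_add_one_self)
  finally have "\<bar>negbin b m\<bar> * \<bar>(b + real m) / real (Suc m)\<bar>
      \<le> exp ((1 - b) * (2 * harm k - harm m)) * exp (- ((1 - b) / real (Suc m)))"
    using step by (intro mult_mono) auto
  also have "\<dots> = exp ((1 - b) * (2 * harm k - harm (Suc m)))"
    by (simp add: harm_Suc exp_add [symmetric] algebra_simps divide_inverse)
  finally show ?case
    by (simp add: negbin_Suc abs_mult)
qed

lemma negbin_bound:
  assumes "0 < m"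
  shows "real m powr (1 - b) * \<bar>negbin b m\<bar> \<le> growth \<bar>1 - b\<bar>"
proof -
  have ln: "0 \<le> ln (real m)" using assms by simp
  have *: "real m powr (1 - b) * \<bar>negbin b m\<bar> \<le> growth \<bar>1 - b\<bar>"
    if "\<bar>negbin b m\<bar> \<le> exp s" "(1 - b) * ln (real m) + s \<le> 2 * \<bar>1 - b\<bar> * (1 + ln (\<bar>1 - b\<bar> + 2))" for s
  proof -
    have "real m powr (1 - b) * \<bar>negbin b m\<bar> \<le> exp ((1 - b) * ln (real m)) * exp s"
      using that assms by (simp add: powr_def)
    also have "\<dots> \<le> growth \<bar>1 - b\<bar>"
      using that unfolding growth_def exp_add [symmetric] by simp
    finally show ?thesis .
  qed
  \<comment> \<open>For \<open>b > 1\<close> the logarithm of \<open>m^(1 - b)\<close> cancels the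
    harmonic number. For \<open>b \<le> 1\<close> a small \<open>m\<close> is controlled by
    \<open>|1 - b|\<close>, and a large \<open>m\<close> needs the decay.\<close>
  consider "1 < b" | "b \<le> 1" "real m \<le> \<bar>1 - b\<bar> + 2" | "b \<le> 1" "\<bar>1 - b\<bar> + 2 < real m"
    by linarith
  then show ?thesis
  proof cases
    case 1
    have "(1 - b) * ln (real m) + \<bar>1 - b\<bar> * harm m = \<bar>1 - b\<bar> * (harm m - ln (real m))"
      using 1 by (simp add: algebra_simps)
    also have "\<dots> \<le> \<bar>1 - b\<bar> * (2 * (1 + ln (\<bar>1 - b\<bar> + 2)))"
    proof (rule mult_left_mono)
      have "harm m - ln (real m) \<le> 2 * (1 + L)" if "0 \<le> L" for L :: real
        using harm_le_ln [OF assms] that by simp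
      then show "harm m - ln (real m) \<le> 2 * (1 + ln (\<bar>1 - b\<bar> + 2))"
        by simp
    qed simp
    finally show ?thesis
      by (intro * [OF abs_negbin_le]) (simp only: mult_ac)
  next
    case 2
    have "ln (real m) \<le> ln (\<bar>1 - b\<bar> + 2)"
      using 2 assms by simp
    then have "(1 - b) * (ln (real m) + harm m) \<le> (1 - b) * (2 * (1 + ln (\<bar>1 - b\<bar> + 2)))"
      using harm_le_ln [OF assms] 2 by (intro mult_left_mono) auto
    then show ?thesis
      using 2 by (intro * [OF abs_negbin_le]) (auto simp: algebra_simps)
  next
    case 3
    \<comment> \<open>An index at which the decay has set in, yet small enough that
      \<open>|1 - b|\<close> controls \<open>ln k\<close>.\<close>
    define k where "k = Suc (nat \<lfloor>1 - b\<rfloor>)"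
    have k: "1 - b \<le> real k" "real k \<le> \<bar>1 - b\<bar> + 2" "0 < k" "k \<le> m"
      using 3 unfolding k_def by linarith+
    have "ln (real k) \<le> ln (\<bar>1 - b\<bar> + 2)"
      using k by simp
    then have "2 * harm k - harm m + ln (real m) \<le> 2 * (1 + ln (\<bar>1 - b\<bar> + 2))"
      using harm_le_ln [OF k(3)] euler_mascheroni_sequence_nonneg [OF assms] by simp
    then have "(1 - b) * (2 * harm k - harm m + ln (real m)) \<le> (1 - b) * (2 * (1 + ln (\<bar>1 - b\<bar> + 2)))"
      using 3 by (intro mult_left_mono) auto
    then show ?thesis
      using 3 by (intro * [OF abs_negbin_le_decay [OF k(1,4)]]) (auto simp: algebra_simps)
  qed
qed

lemma power_div_fact_le_exp:
  fixes x :: real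
  assumes "0 \<le> x"
  shows "x ^ n / fact n \<le> exp x"
proof -
  have "(\<Sum>k\<in>{n}. x ^ k /\<^sub>R fact k) \<le> (\<Sum>k. x ^ k /\<^sub>R fact k)"
    using assms by (intro sum_le_suminf summable_exp_generic) auto
  then show ?thesis
    by (simp add: exp_def field_simps)
qed

lemma summable_growth:
  assumes "0 < a" "a < 1 / 2" "0 \<le> c" "0 \<le> r"
  shows "summable (\<lambda>j. r ^ j / fact j * growth (c + a * real j))"
proof (rule summable_comparison_test_ev)
  \<comment> \<open>Positive even for \<open>r = 0\<close>, so that \<open>R^j\<close> is
    \<open>exp (j ln R)\<close>.\<close>
  define R where "R = r + 1"
  \<comment> \<open>The left side is of order \<open>2 a j ln j\<close> with \<open>2 a < 1\<close>.
    Of the spare \<open>2 j\<close>, one \<open>j\<close> pays for the bound on \<open>j!\<close>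
    and the other gives the ratio \<open>exp (- 1)\<close>.\<close>
  have "\<forall>\<^sub>F j in sequentially. real j * ln R + 2 * (c + a * real j) * (1 + ln (c + a * real j + 2))
      \<le> real j * ln (real j) - 2 * real j"
    using assms by real_asymp
  then show "\<forall>\<^sub>F j in sequentially. norm (r ^ j / fact j * growth (c + a * real j)) \<le> exp (- 1) ^ j"
    using eventually_gt_at_top [of 0]
  proof eventually_elim
    case (elim j)
    have "r ^ j \<le> R ^ j"
      using assms by (intro power_mono) (auto simp: R_def)
    also have "R ^ j = exp (real j * ln R)"
      using assms by (simp add: R_def exp_of_nat_mult)
    finally have r: "r ^ j \<le> exp (real j * ln R)" .
    have "real j ^ j = exp (real j * ln (real j))"
      using elim by (simp add: exp_of_nat_mult)
    \<comment> \<open>A weak Stirling bound: \<open>j!\<close> is at least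
      \<open>(j / e)^j\<close>.\<close>
    then have "exp (real j * ln (real j)) / exp (real j) \<le> fact j"
      using power_div_fact_le_exp [of "real j" j] by (simp add: field_simps)
    then have "r ^ j / fact j \<le> exp (real j * ln R) / (exp (real j * ln (real j)) / exp (real j))"
      using r assms by (intro frac_le) auto
    also have "\<dots> = exp (real j * ln R - real j * ln (real j) + real j)"
      by (simp add: exp_diff exp_add)
    finally have "r ^ j / fact j * growth (c + a * real j) \<le>
        exp (real j * ln R - real j * ln (real j) + real j) * growth (c + a * real j)"
      by (intro mult_right_mono) (auto simp: growth_def)
    also have "\<dots> \<le> exp (- real j)"
      using elim(1) by (simp add: growth_def exp_add [symmetric] algebra_simps)
    finally show ?case
      using assms by (simp add: growth_def exp_of_nat_mult [symmetric])
  qed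
qed simp

subsection \<open>Discretised Wright functions\<close>

text \<open>\<open>wcoeff a \<beta> y m\<close> is the coefficient of \<open>z\<^sup>m\<close> in \<open>(1 - z)\<^sup>-\<^sup>\<beta> exp (- y (1 - z)\<^sup>a)\<close>.\<close>

definition wcoeff :: "real \<Rightarrow> real \<Rightarrow> real \<Rightarrow> nat \<Rightarrow> real" where
  "wcoeff a \<beta> y m = (\<Sum>j. (- y) ^ j / fact j * negbin (\<beta> - a * real j) m)"

lemma growth_shift_le:
  assumes "0 < a"
  shows "growth \<bar>1 - (\<beta> - a * real j)\<bar> \<le> growth (\<bar>1 - \<beta>\<bar> + a * real j)"
proof (rule growth_mono)
  have "0 \<le> a * real j" using assms by simp
  then show "\<bar>1 - (\<beta> - a * real j)\<bar> \<le> \<bar>1 - \<beta>\<bar> + a * real j" by linarith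
qed simp

text \<open>At \<open>y = x m^a\<close> the power \<open>m^(a j)\<close> from \<open>y^j\<close>
  turns the common normalisation \<open>m^(1 - \<beta>)\<close> into the one that
  \<open>negbin_tendsto\<close> and \<open>negbin_bound\<close> use for the parameter
  \<open>\<beta> - a j\<close>.\<close>

lemma wcoeff_term_scaled:
  assumes "0 < m"
  shows "real m powr (1 - \<beta>) * ((- (x * real m powr a)) ^ j / fact j * negbin (\<beta> - a * real j) m)
       = (- x) ^ j / fact j * (real m powr (1 - (\<beta> - a * real j)) * negbin (\<beta> - a * real j) m)"
proof -
  have "(real m powr a) ^ j = real m powr (a * real j)"
    using assms by (simp add: powr_power mult.commute)
  then have *: "(- (x * real m powr a)) ^ j = (- x) ^ j * real m powr (a * real j)"
    using power_mult_distrib [of "- x" "real m powr a" j] by simp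
  have "1 - (\<beta> - a * real j) = (1 - \<beta>) + a * real j"
    by simp
  then have **: "real m powr (1 - (\<beta> - a * real j)) = real m powr (1 - \<beta>) * real m powr (a * real j)"
    by (simp only: powr_add)
  show ?thesis
    unfolding * ** times_divide_eq_left times_divide_eq_right by (simp only: mult_ac)
qed

context
  fixes a :: real
  assumes a: "0 < a" "a < 1 / 2"
begin

section \<open>Convergence of the discretisation to the Wright function\<close>

lemma norm_scaled_term_le:
  assumes "0 < m"
  shows "norm ((- x) ^ j / fact j * (real m powr (1 - (\<beta> - a * real j)) * negbin (\<beta> - a * real j) m))
      \<le> \<bar>x\<bar> ^ j / fact j * growth (\<bar>1 - \<beta>\<bar> + a * real j)"
proof -
  have "real m powr (1 - (\<beta> - a * real j)) * \<bar>negbin (\<beta> - a * real j) m\<bar>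
      \<le> growth (\<bar>1 - \<beta>\<bar> + a * real j)"
    using negbin_bound [OF assms] growth_shift_le [OF a(1)] by (rule order_trans)
  then have "\<bar>x\<bar> ^ j / fact j * (real m powr (1 - (\<beta> - a * real j)) * \<bar>negbin (\<beta> - a * real j) m\<bar>)
      \<le> \<bar>x\<bar> ^ j / fact j * growth (\<bar>1 - \<beta>\<bar> + a * real j)"
    by (intro mult_left_mono) auto
  then show ?thesis
    by (simp add: abs_mult power_abs)
qed

lemma summable_wcoeff: "summable (\<lambda>j. (- y) ^ j / fact j * negbin (\<beta> - a * real j) m)"
proof (cases "m = 0")
  case True
  then show ?thesis
    using summable_exp [of "- y"] by (simp add: divide_inverse mult.commute)
next
  case False
  define x where "x = y / real m powr a"
  have y: "y = x * real m powr a"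
    using False by (simp add: x_def)
  have "summable (\<lambda>j. real m powr (1 - \<beta>) * ((- y) ^ j / fact j * negbin (\<beta> - a * real j) m))"
    unfolding y
  proof (rule summable_comparison_test')
    show "summable (\<lambda>j. \<bar>x\<bar> ^ j / fact j * growth (\<bar>1 - \<beta>\<bar> + a * real j))"
      using a by (intro summable_growth) auto
    show "norm (real m powr (1 - \<beta>) * ((- (x * real m powr a)) ^ j / fact j * negbin (\<beta> - a * real j) m))
        \<le> \<bar>x\<bar> ^ j / fact j * growth (\<bar>1 - \<beta>\<bar> + a * real j)" for j
      using False norm_scaled_term_le [of m] by (simp only: wcoeff_term_scaled)
  qed
  moreover have "real m powr (1 - \<beta>) \<noteq> 0"
    using False by simp
  ultimately show ?thesis
    by (rule summable_mult_D)
qed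

text \<open>Tannery's theorem, dominated convergence for series, with a majorant independent of
  \<open>m\<close>; it also delivers absolute convergence of the Wright series.\<close>

lemma wcoeff_limit_aux:
  "summable (\<lambda>j. norm ((- x) ^ j / fact j * rGamma (\<beta> - a * real j))) \<and>
   (\<lambda>m. \<Sum>j. (- x) ^ j / fact j * (real m powr (1 - (\<beta> - a * real j)) * negbin (\<beta> - a * real j) m))
     \<longlonglongrightarrow> (\<Sum>j. (- x) ^ j / fact j * rGamma (\<beta> - a * real j))"
proof -
  let ?f = "\<lambda>j m. (- x) ^ j / fact j * (real m powr (1 - (\<beta> - a * real j)) * negbin (\<beta> - a * real j) m)"
  let ?M = "\<lambda>j. \<bar>x\<bar> ^ j / fact j * growth (\<bar>1 - \<beta>\<bar> + a * real j)"
  have "\<forall>\<^sub>F (j, m) in sequentially \<times>\<^sub>F sequentially. norm (?f j m) \<le> ?M j"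
    unfolding eventually_prod_filter
  proof (intro exI conjI allI impI)
    show "\<forall>\<^sub>F j in sequentially. (\<lambda>_. True) (j :: nat)" by simp
    show "\<forall>\<^sub>F m in sequentially. (0::nat) < m" by (rule eventually_gt_at_top)
    show "case (j, m) of (j, m) \<Rightarrow> norm (?f j m) \<le> ?M j" if "0 < m" for j m
      unfolding prod.case using that by (rule norm_scaled_term_le)
  qed
  moreover have "summable ?M"
    using a by (intro summable_growth) auto
  ultimately have "(\<forall>\<^sub>F m in sequentially. summable (\<lambda>j. norm (?f j m))) \<and>
      summable (\<lambda>j. norm ((- x) ^ j / fact j * rGamma (\<beta> - a * real j))) \<and>
      (\<lambda>m. \<Sum>j. ?f j m) \<longlonglongrightarrow> (\<Sum>j. (- x) ^ j / fact j * rGamma (\<beta> - a * real j))"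
    by (intro tannerys_theorem tendsto_mult_left negbin_tendsto trivial_limit_sequentially)
  then show ?thesis by (rule conjunct2)
qed

lemma summable_wright: "summable (\<lambda>j. x ^ j / fact j * rGamma (- a * real j + \<beta>))"
proof -
  have "\<beta> - a * real j = - a * real j + \<beta>" for j by simp
  then show ?thesis
    using summable_norm_cancel [OF conjunct1 [OF wcoeff_limit_aux [of "- x" \<beta>]]] by simp
qed

lemma wcoeff_tendsto:
  "(\<lambda>m. real m powr (1 - \<beta>) * wcoeff a \<beta> (x * real m powr a) m) \<longlonglongrightarrow> wright (- x) (- a) \<beta>"
proof (rule Lim_transform_eventually)
  show "(\<lambda>m. \<Sum>j. (- x) ^ j / fact j * (real m powr (1 - (\<beta> - a * real j)) * negbin (\<beta> - a * real j) m))
     \<longlonglongrightarrow> wright (- x) (- a) \<beta>"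
    using wcoeff_limit_aux [of x \<beta>] by (simp add: wright_def algebra_simps)
  show "\<forall>\<^sub>F m in sequentially.
      (\<Sum>j. (- x) ^ j / fact j * (real m powr (1 - (\<beta> - a * real j)) * negbin (\<beta> - a * real j) m))
      = real m powr (1 - \<beta>) * wcoeff a \<beta> (x * real m powr a) m"
    using eventually_gt_at_top [of 0]
    by eventually_elim
      (simp only: wcoeff_def suminf_mult [OF summable_wcoeff, symmetric] wcoeff_term_scaled)
qed

section \<open>Generating function identities, positivity and the discrete extremum
  principle\<close>

lemma wcoeff_add: "wcoeff a (\<beta> + \<gamma>) y m = (\<Sum>k\<le>m. wcoeff a \<beta> y k * negbin \<gamma> (m - k))"
proof -
  have "(- y) ^ j / fact j * negbin (\<beta> + \<gamma> - a * real j) m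
      = (\<Sum>k\<le>m. (- y) ^ j / fact j * negbin (\<beta> - a * real j) k * negbin \<gamma> (m - k))" for j
    using negbin_add [of "\<beta> - a * real j" \<gamma> m]
    by (simp add: sum_distrib_left algebra_simps)
  then have "wcoeff a (\<beta> + \<gamma>) y m
      = (\<Sum>j. \<Sum>k\<le>m. (- y) ^ j / fact j * negbin (\<beta> - a * real j) k * negbin \<gamma> (m - k))"
    by (simp add: wcoeff_def)
  also have "\<dots> = (\<Sum>k\<le>m. \<Sum>j. (- y) ^ j / fact j * negbin (\<beta> - a * real j) k * negbin \<gamma> (m - k))"
    by (intro suminf_sum summable_mult2 summable_wcoeff)
  finally show ?thesis
    unfolding wcoeff_def suminf_mult2 [OF summable_wcoeff] .
qed

text \<open>The factor \<open>- a j\<close>, as left by differentiating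
  \<open>(1 - z)^(a j)\<close>, cancels against \<open>j!\<close>; the index shift then absorbs the
  \<open>+ a\<close> in the parameter.\<close>

lemma suminf_shift_wcoeff:
  "(\<Sum>j. (- y) ^ j / fact j * (- a * real j) * negbin (\<beta> + a - a * real j) m) = y * a * wcoeff a \<beta> y m"
proof -
  let ?f = "\<lambda>j. (- y) ^ j / fact j * (- a * real j) * negbin (\<beta> + a - a * real j) m"
  have f: "?f (Suc j) = y * a * ((- y) ^ j / fact j * negbin (\<beta> - a * real j) m)" for j
    by (simp add: field_simps del: of_nat_Suc) (simp add: algebra_simps)
  have "summable (\<lambda>j. ?f (Suc j))"
    unfolding f by (intro summable_mult summable_wcoeff)
  then have "summable ?f"
    by (rule summable_Suc_iff [THEN iffD1])
  from suminf_split_head [OF this] have "suminf ?f = (\<Sum>j. ?f (Suc j))"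
    by simp
  also have "\<dots> = y * a * wcoeff a \<beta> y m"
    unfolding f wcoeff_def by (rule suminf_mult [OF summable_wcoeff])
  finally show ?thesis .
qed

lemma wcoeff_0_Suc: "real (Suc m) * wcoeff a 0 y (Suc m) = y * a * wcoeff a (1 - a) y m"
proof -
  have "real (Suc m) * wcoeff a 0 y (Suc m)
      = (\<Sum>j. real (Suc m) * ((- y) ^ j / fact j * negbin (0 - a * real j) (Suc m)))"
    unfolding wcoeff_def by (rule suminf_mult [OF summable_wcoeff, symmetric])
  also have "\<dots> = (\<Sum>j. (- y) ^ j / fact j * (- a * real j) * negbin (1 - a + a - a * real j) m)"
  proof (rule suminf_cong)
    fix j
    have "real (Suc m) * ((- y) ^ j / fact j * negbin (0 - a * real j) (Suc m))
        = (- y) ^ j / fact j * (real (Suc m) * negbin (0 - a * real j) (Suc m))"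
      by (rule mult.left_commute)
    then show "real (Suc m) * ((- y) ^ j / fact j * negbin (0 - a * real j) (Suc m))
        = (- y) ^ j / fact j * (- a * real j) * negbin (1 - a + a - a * real j) m"
      unfolding negbin_Suc_shift by (simp add: add.commute)
  qed
  also have "\<dots> = y * a * wcoeff a (1 - a) y m"
    by (rule suminf_shift_wcoeff)
  finally show ?thesis .
qed

text \<open>
  The derivative of \<open>exp (- y (1 - z)\<^sup>a)\<close> is its product with \<open>y a (1 - z)\<^sup>a\<^sup>-\<^sup>1\<close>, which has
  nonnegative coefficients.
\<close>

lemma wcoeff_nonneg:
  assumes "0 \<le> y" "0 \<le> \<beta>"
  shows "0 \<le> wcoeff a \<beta> y m"
proof -
  have "0 \<le> wcoeff a 0 y m" for m
  proof (induction m rule: less_induct)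
    case (less m)
    show ?case
    proof (cases m)
      case 0
      have "wcoeff a 0 y 0 = exp (- y)"
        by (simp add: wcoeff_def exp_def divide_inverse mult.commute)
      then show ?thesis using 0 by simp
    next
      case (Suc n)
      \<comment> \<open>Convolution with \<open>(1 - z)^(a - 1)\<close> involves the coefficients
        for \<open>\<beta> = 0\<close> only up to index \<open>n\<close>, where the induction
        hypothesis applies.\<close>
      have "0 \<le> wcoeff a (0 + (1 - a)) y n"
        unfolding wcoeff_add
        using a less Suc by (intro sum_nonneg mult_nonneg_nonneg negbin_nonneg) auto
      then have "0 \<le> real (Suc n) * wcoeff a 0 y (Suc n)"
        using assms a by (simp add: wcoeff_0_Suc del: of_nat_Suc)
      then show ?thesis
        using Suc by (simp add: zero_le_mult_iff del: of_nat_Suc)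
    qed
  qed
  then have "0 \<le> wcoeff a (0 + \<beta>) y m"
    unfolding wcoeff_add using assms by (intro sum_nonneg mult_nonneg_nonneg negbin_nonneg) auto
  then show ?thesis by simp
qed

text \<open>After clearing denominators, the increment is \<open>y a\<close> times a coefficient
  with parameter \<open>1 - 2 a > 0\<close>, hence nonnegative. With \<open>y = x m^a\<close> and
  \<open>k\<close> near \<open>\<tau> m\<close> this mirrors the growth of
  \<open>M(x \<tau>^(-a))\<close> in \<open>\<tau>\<close>.\<close>

lemma wcoeff_ratio_mono:
  assumes "0 \<le> y" "k \<le> m"
  shows "wcoeff a (1 - a) y k / negbin (1 - a) k \<le> wcoeff a (1 - a) y m / negbin (1 - a) m"
proof (rule lift_Suc_mono_le [OF _ assms(2)])
  fix k
  have "real (Suc k) * wcoeff a (1 - a) y (Suc k) - (1 - a + real k) * wcoeff a (1 - a) y k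
      = (\<Sum>j. real (Suc k) * ((- y) ^ j / fact j * negbin (1 - a - a * real j) (Suc k))
          - (1 - a + real k) * ((- y) ^ j / fact j * negbin (1 - a - a * real j) k))"
    unfolding wcoeff_def
    by (simp only: suminf_mult [OF summable_wcoeff, symmetric]
        suminf_diff [OF summable_mult [OF summable_wcoeff] summable_mult [OF summable_wcoeff]])
  also have "\<dots> = (\<Sum>j. (- y) ^ j / fact j * (- a * real j) * negbin (1 - 2 * a + a - a * real j) k)"
  proof (rule suminf_cong)
    fix j
    let ?X = "(- y) ^ j / fact j" and ?b = "1 - a - a * real j"
    have "real (Suc k) * (?X * negbin ?b (Suc k)) - (1 - a + real k) * (?X * negbin ?b k)
        = ?X * (real (Suc k) * negbin ?b (Suc k) - (1 - a + real k) * negbin ?b k)"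
      by (simp only: right_diff_distrib mult.left_commute)
    also have "\<dots> = ?X * ((- a * real j) * negbin ?b k)"
    proof -
      have "real (Suc k) * negbin ?b (Suc k) = (?b + real k) * negbin ?b k"
        by (simp add: negbin_Suc del: of_nat_Suc)
      then show ?thesis
        by (simp only: left_diff_distrib [symmetric]) simp
    qed
    finally show "real (Suc k) * (?X * negbin ?b (Suc k)) - (1 - a + real k) * (?X * negbin ?b k)
        = ?X * (- a * real j) * negbin (1 - 2 * a + a - a * real j) k"
      by (simp add: algebra_simps)
  qed
  also have "\<dots> = y * a * wcoeff a (1 - 2 * a) y k"
    by (rule suminf_shift_wcoeff)
  also have "\<dots> \<ge> 0"
    using assms a by (intro mult_nonneg_nonneg wcoeff_nonneg) auto
  finally have "(1 - a + real k) * wcoeff a (1 - a) y k \<le> real (Suc k) * wcoeff a (1 - a) y (Suc k)"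
    by simp
  moreover have "0 < negbin (1 - a) k" "0 < 1 - a + real k"
    using a by (auto intro!: negbin_pos)
  ultimately show "wcoeff a (1 - a) y k / negbin (1 - a) k
      \<le> wcoeff a (1 - a) y (Suc k) / negbin (1 - a) (Suc k)"
    by (simp add: negbin_Suc divide_simps mult.commute del: of_nat_Suc)
qed

text \<open>
  A discrete extremum principle: \<open>(1 - z)\<^sup>1\<^sup>-\<^sup>2\<^sup>a\<close> acts as the fractional derivative, and all its
  coefficients but the first are negative.
\<close>

lemma wcoeff_gap:
  assumes "0 \<le> y"
  defines "R \<equiv> \<lambda>k. wcoeff a (1 - a) y k / negbin (1 - a) k"
  assumes "n < m"
  shows "(R m - R n) * (- negbin (2 * a - 1) m) * negbin (2 - a) n
    \<le> wcoeff a a y m - R m * negbin a m"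
proof -
  let ?q = "\<lambda>k. negbin (2 * a - 1) k" and ?p = "\<lambda>k. negbin (1 - a) k"
  have p: "0 < ?p k" for k
    using a by (simp add: negbin_pos)
  have q_Suc: "- ?q (Suc (Suc k)) = - ?q (Suc k) * ((2 * a + real k) / real (Suc (Suc k)))" for k
    by (simp add: negbin_Suc [of _ "Suc k"])
  have q_nonneg: "0 \<le> - ?q (Suc k)" for k
  proof (induction k)
    case 0
    show ?case using a by (simp add: negbin_Suc)
  next
    case (Suc k)
    then show ?case
      unfolding q_Suc using a by (intro mult_nonneg_nonneg) auto
  qed
  have q_decr: "- ?q (Suc k) \<le> - ?q (Suc l)" if "l \<le> k" for k l
  proof (rule lift_Suc_antimono_le [OF _ that])
    fix k
    have "(2 * a + real k) / real (Suc (Suc k)) \<le> 1"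
      using a by simp
    then show "- ?q (Suc (Suc k)) \<le> - ?q (Suc k)"
      unfolding q_Suc using q_nonneg by (intro mult_left_le) auto
  qed
  have R_mono: "R k \<le> R l" if "k \<le> l" for k l
    unfolding R_def using wcoeff_ratio_mono assms(1) that by blast
  have A: "wcoeff a (1 - a) y k = R k * ?p k" for k
    using p [of k] by (simp add: R_def)
  have "(R m - R n) * (- ?q m) * negbin (2 - a) n = (\<Sum>k\<le>n. (R m - R n) * ?p k * (- ?q m))"
    using sum_negbin [of "1 - a" n]
    by (simp only: sum_distrib_left [symmetric] sum_distrib_right [symmetric]) (simp add: mult_ac)
  \<comment> \<open>For \<open>k \<le> n\<close> the ratio \<open>R k\<close> is at most
    \<open>R n\<close>, and \<open>- ?q\<close> decreases from index 1 on; \<open>n < m\<close>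
    keeps \<open>m - k\<close> at least 1.\<close>
  also have "\<dots> \<le> (\<Sum>k\<le>n. (R m - R k) * ?p k * (- ?q (m - k)))"
  proof (intro sum_mono mult_mono)
    fix k assume "k \<in> {..n}"
    then obtain l where l: "m - k = Suc l" "Suc l \<le> m" "k \<le> n"
      using assms(3) by (metis Suc_diff_Suc atMost_iff diff_le_self le_less_trans)
    show "R m - R n \<le> R m - R k" "0 \<le> R m - R k" "0 \<le> ?p k" "0 \<le> (R m - R k) * ?p k"
      using R_mono l p [of k] assms(3) by auto
    obtain m' where m': "m = Suc m'"
      using assms(3) by (cases m) auto
    show "- ?q m \<le> - ?q (m - k)" "0 \<le> - ?q m"
      unfolding l(1) unfolding m' using l m' q_decr q_nonneg by auto
  qed simp
  \<comment> \<open>The coefficient \<open>?q 0 = 1\<close> of the wrong sign occurs only at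
    \<open>k = m\<close>, where \<open>R m - R k\<close> vanishes.\<close>
  also have "\<dots> \<le> (\<Sum>k\<le>m. (R m - R k) * ?p k * (- ?q (m - k)))"
  proof (rule sum_mono2)
    fix k assume k: "k \<in> {..m} - {..n}"
    show "0 \<le> (R m - R k) * ?p k * (- ?q (m - k))"
    proof (cases "m - k")
      case 0
      then show ?thesis using k by auto
    next
      case (Suc l)
      then show ?thesis
        using k R_mono p [of k] q_nonneg [of l] by (intro mult_nonneg_nonneg) auto
    qed
  qed (use assms(3) in auto)
  also have "\<dots> = (\<Sum>k\<le>m. R k * ?p k * ?q (m - k)) - R m * (\<Sum>k\<le>m. ?p k * ?q (m - k))"
    by (simp add: sum_distrib_left sum_subtractf [symmetric] algebra_simps)
  also have "\<dots> = wcoeff a a y m - R m * negbin a m"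
    using wcoeff_add [of "1 - a" "2 * a - 1" y m] negbin_add [of "1 - a" "2 * a - 1" m] by (simp add: A)
  finally show ?thesis .
qed

end

subsection \<open>Wright functions\<close>

text \<open>A negative slope at \<open>u\<close> would make \<open>f\<close> drop just to the right
  of \<open>u\<close>, and a nonincreasing function cannot climb back to its old value at
  \<open>v\<close>.\<close>

lemma has_derivative_zero_if_flat:
  fixes f f' :: "real \<Rightarrow> real"
  assumes "u < v" "f u = f v"
    and deriv: "\<And>x. (f has_real_derivative f' x) (at x)"
    and nonpos: "\<And>x. u \<le> x \<Longrightarrow> f' x \<le> 0"
  shows "f' u = 0"
proof (rule ccontr)
  assume "f' u \<noteq> 0"
  with nonpos [of u] have "f' u < 0" by simp
  from DERIV_neg_dec_right [OF deriv this] obtain d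
    where d: "0 < d" "\<And>h. 0 < h \<Longrightarrow> h < d \<Longrightarrow> f (u + h) < f u"
    by blast
  define h where "h = min (d / 2) (v - u)"
  have h: "0 < h" "h < d" "u + h \<le> v"
    using d(1) assms(1) by (auto simp: h_def min_def)
  have "f (u + h) \<ge> f v"
  proof (rule DERIV_nonpos_imp_nonincreasing [OF h(3)])
    fix x assume "u + h \<le> x"
    then show "\<exists>y. (f has_real_derivative y) (at x) \<and> y \<le> 0"
      using deriv nonpos h(1) by (intro exI [of _ "f' x"]) auto
  qed
  then show False
    using d(2) [OF h(1,2)] assms(2) by simp
qed

context
  fixes a :: real
  assumes a: "0 < a" "a < 1 / 2"
begin

lemma wright_has_derivative:
  "((\<lambda>x. wright (- x) (- a) \<beta>) has_real_derivative - wright (- x) (- a) (\<beta> - a)) (at x)"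
proof -
  let ?c = "\<lambda>j. rGamma (- a * real j + \<beta>) / fact j"
  have w: "(\<lambda>x. wright x (- a) \<beta>) = (\<lambda>x. \<Sum>j. ?c j * x ^ j)"
    by (simp add: wright_def mult_ac)
  have "summable (\<lambda>j. ?c j * y ^ j)" for y
    using summable_wright [OF a, of y \<beta>] by (simp add: mult_ac)
  then have "((\<lambda>x. \<Sum>j. ?c j * x ^ j) has_real_derivative (\<Sum>j. diffs ?c j * y ^ j)) (at y)" for y
    by (rule termdiffs_strong_converges_everywhere)
  moreover have "diffs ?c j = rGamma (- a * real j + (\<beta> - a)) / fact j" for j
  proof -
    have "- a * real (Suc j) + \<beta> = - a * real j + (\<beta> - a)"
      by (simp add: algebra_simps)
    then show ?thesis
      by (simp only: diffs_def fact_Suc of_nat_mult) simp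
  qed
  ultimately have "((\<lambda>x. wright x (- a) \<beta>) has_real_derivative wright y (- a) (\<beta> - a)) (at y)" for y
    unfolding w by (simp add: wright_def mult_ac)
  from DERIV_chain2 [OF this DERIV_minus [OF DERIV_ident]] show ?thesis
    by simp
qed

lemma wright_nonneg:
  assumes "0 \<le> x" "0 \<le> \<beta>"
  shows "0 \<le> wright (- x) (- a) \<beta>"
proof (rule LIMSEQ_le_const [OF wcoeff_tendsto [OF a]], intro exI allI impI)
  show "0 \<le> real n powr (1 - \<beta>) * wcoeff a \<beta> (x * real n powr a) n" for n
    using assms by (intro mult_nonneg_nonneg wcoeff_nonneg [OF a]) auto
qed

lemma wright_0: "wright 0 \<rho> \<beta> = rGamma \<beta>"
proof -
  have "wright 0 \<rho> \<beta> = (\<Sum>k. rGamma (\<rho> * real k + \<beta>) / fact k * 0 ^ k)"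
    by (simp add: wright_def mult_ac)
  then show ?thesis
    by (simp only: powser_zero) simp
qed

text \<open>Termwise \<open>rGamma z = z * rGamma (z + 1)\<close> at \<open>z = a - a j\<close>; an
  index shift absorbs the factor \<open>j\<close>. It identifies the right side of the equation for
  \<xi> as \<open>W\<^sub>a / a\<close>.\<close>

lemma wright_recurrence:
  "wright (- x) (- a) a = a * (x * wright (- x) (- a) 1 + wright (- x) (- a) (1 + a))"
proof -
  let ?f = "\<lambda>\<beta> j. (- x) ^ j / fact j * rGamma (- a * real j + \<beta>)"
  note sm = summable_wright [OF a, of "- x"]
  have rec: "?f a j = a * ?f (1 + a) j - a * (real j * ?f (1 + a) j)" for j
  proof -
    have *: "rGamma (- a * real j + a) = (- a * real j + a) * rGamma (- a * real j + (1 + a))"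
      using rGamma_plus1 [of "- a * real j + a"] by (simp only: add_ac)
    have "X * ((- a * real j + a) * r) = a * (X * r) - a * (real j * (X * r))" for X r :: real
      by (simp add: algebra_simps)
    then show ?thesis
      unfolding * by this
  qed
  have shift: "real (Suc j) * ?f (1 + a) (Suc j) = - x * ?f 1 j" for j
  proof -
    have "- a * real (Suc j) + (1 + a) = - a * real j + 1"
      by (simp add: algebra_simps)
    then show ?thesis
      by (simp only:) (simp del: of_nat_Suc)
  qed
  have "summable (\<lambda>j. real (Suc j) * ?f (1 + a) (Suc j))"
    unfolding shift by (intro summable_mult sm)
  then have sm': "summable (\<lambda>j. real j * ?f (1 + a) j)"
    by (rule summable_Suc_iff [THEN iffD1])
  have "(\<Sum>j. real j * ?f (1 + a) j) = (\<Sum>j. real (Suc j) * ?f (1 + a) (Suc j))"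
    using suminf_split_head [OF sm'] by simp
  also have "\<dots> = - x * wright (- x) (- a) 1"
    unfolding shift wright_def by (rule suminf_mult [OF sm])
  finally have *: "(\<Sum>j. real j * ?f (1 + a) j) = - x * wright (- x) (- a) 1" .
  have "wright (- x) (- a) a = (\<Sum>j. a * ?f (1 + a) j - a * (real j * ?f (1 + a) j))"
    unfolding wright_def rec ..
  also have "\<dots> = a * wright (- x) (- a) (1 + a) - a * (\<Sum>j. real j * ?f (1 + a) j)"
    unfolding wright_def
    by (simp only: suminf_diff [OF summable_mult [OF sm] summable_mult [OF sm'], symmetric]
        suminf_mult [OF sm] suminf_mult [OF sm'])
  finally show ?thesis
    unfolding * by (simp add: algebra_simps)
qed

text \<open>The limit of \<open>wcoeff_gap\<close> along \<open>m = 2 n\<close>. Here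
  \<open>M\<close> is normalised to \<open>M 0 = 1\<close>, and \<open>C\<close> collects the limits
  of the two scaled binomial coefficients and the factor \<open>2^(a - 1)\<close> left over from
  \<open>(2 n)^(a - 1)\<close>.\<close>

lemma wright_gap:
  assumes "0 \<le> x"
  defines "C \<equiv> 2 powr (a - 1) * (- rGamma (2 * a - 1)) * rGamma (2 - a)"
  defines "M \<equiv> \<lambda>x. wright (- x) (- a) (1 - a) / rGamma (1 - a)"
  shows "(M x - M (2 powr a * x)) * C \<le> wright (- x) (- a) a - M x * rGamma a"
proof -
  let ?m = "\<lambda>n::nat. 2 * n"
  let ?R = "\<lambda>y k. wcoeff a (1 - a) y k / negbin (1 - a) k"
  let ?y = "\<lambda>n. x * real (?m n) powr a"
  have sub: "strict_mono ?m"
    by (simp add: strict_mono_def)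
  have R: "(\<lambda>k. ?R (z * real k powr a) k) \<longlonglongrightarrow> M z" for z
  proof (rule Lim_transform_eventually)
    show "(\<lambda>k. (real k powr (1 - (1 - a)) * wcoeff a (1 - a) (z * real k powr a) k)
        / (real k powr (1 - (1 - a)) * negbin (1 - a) k)) \<longlonglongrightarrow> M z"
      unfolding M_def using a
      by (intro tendsto_divide wcoeff_tendsto negbin_tendsto) (auto simp: rGamma_eq_zero_iff)
    show "\<forall>\<^sub>F k in sequentially. (real k powr (1 - (1 - a)) * wcoeff a (1 - a) (z * real k powr a) k)
        / (real k powr (1 - (1 - a)) * negbin (1 - a) k) = ?R (z * real k powr a) k"
      using eventually_gt_at_top [of 0] by eventually_elim simp
  qed
  have R_m: "(\<lambda>n. ?R (?y n) (?m n)) \<longlonglongrightarrow> M x"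
    using LIMSEQ_subseq_LIMSEQ [OF R sub] by (simp add: o_def)
  \<comment> \<open>Index \<open>n\<close> sees the same \<open>y\<close> as
    \<open>x (2 n)^a = (2^a x) n^a\<close>.\<close>
  have R_n: "(\<lambda>n. ?R (?y n) n) \<longlonglongrightarrow> M (2 powr a * x)"
    using R [of "2 powr a * x"] by (simp add: powr_mult mult_ac)
  have q: "(\<lambda>n. 2 powr (a - 1) * (- (real (?m n) powr (1 - (2 * a - 1)) * negbin (2 * a - 1) (?m n)))
      * (real n powr (1 - (2 - a)) * negbin (2 - a) n)) \<longlonglongrightarrow> C"
    unfolding C_def
    using LIMSEQ_subseq_LIMSEQ [OF negbin_tendsto [of "2 * a - 1"] sub]
    by (intro tendsto_intros negbin_tendsto) (simp add: o_def)
  have lhs: "(\<lambda>n. (?R (?y n) (?m n) - ?R (?y n) n) *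
      (2 powr (a - 1) * (- (real (?m n) powr (1 - (2 * a - 1)) * negbin (2 * a - 1) (?m n)))
      * (real n powr (1 - (2 - a)) * negbin (2 - a) n)))
      \<longlonglongrightarrow> (M x - M (2 powr a * x)) * C"
    by (intro tendsto_intros R_m R_n q)
  have rhs: "(\<lambda>n. real (?m n) powr (1 - a) * wcoeff a a (?y n) (?m n)
      - ?R (?y n) (?m n) * (real (?m n) powr (1 - a) * negbin a (?m n)))
      \<longlonglongrightarrow> wright (- x) (- a) a - M x * rGamma a"
    using LIMSEQ_subseq_LIMSEQ [OF wcoeff_tendsto [OF a, of a x] sub]
      LIMSEQ_subseq_LIMSEQ [OF negbin_tendsto [of a] sub]
    by (intro tendsto_intros R_m) (simp_all add: o_def)
  show ?thesis
  proof (rule LIMSEQ_le [OF lhs rhs], intro exI [of _ 1] allI impI)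
    fix n :: nat assume n: "1 \<le> n"
    let ?N = "real n"
    have "(2 * ?N) powr (1 - a) = (2 * ?N) powr (1 - (2 * a - 1)) * (2 * ?N) powr (a - 1)"
      by (simp add: powr_add [symmetric])
    also have "(2 * ?N) powr (a - 1) = 2 powr (a - 1) * ?N powr (1 - (2 - a))"
      by (simp add: powr_mult)
    finally have scale: "real (?m n) powr (1 - a)
        = real (?m n) powr (1 - (2 * a - 1)) * (2 powr (a - 1) * ?N powr (1 - (2 - a)))"
      by simp
    have "real (?m n) powr (1 - a) * ((?R (?y n) (?m n) - ?R (?y n) n)
          * (- negbin (2 * a - 1) (?m n)) * negbin (2 - a) n)
        \<le> real (?m n) powr (1 - a) * (wcoeff a a (?y n) (?m n) - ?R (?y n) (?m n) * negbin a (?m n))"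
      using wcoeff_gap [OF a, of "?y n" n "?m n"] assms n by (intro mult_left_mono) auto
    moreover have "real (?m n) powr (1 - a) * ((?R (?y n) (?m n) - ?R (?y n) n)
          * (- negbin (2 * a - 1) (?m n)) * negbin (2 - a) n)
        = (?R (?y n) (?m n) - ?R (?y n) n) *
      (2 powr (a - 1) * (- (real (?m n) powr (1 - (2 * a - 1)) * negbin (2 * a - 1) (?m n)))
      * (?N powr (1 - (2 - a)) * negbin (2 - a) n))"
      unfolding scale by (simp only: mult_minus_left mult_minus_right mult_ac)
    moreover have "real (?m n) powr (1 - a) * (wcoeff a a (?y n) (?m n) - ?R (?y n) (?m n) * negbin a (?m n))
        = real (?m n) powr (1 - a) * wcoeff a a (?y n) (?m n)
          - ?R (?y n) (?m n) * (real (?m n) powr (1 - a) * negbin a (?m n))"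
      by (simp only: right_diff_distrib mult.left_commute)
    ultimately show "(?R (?y n) (?m n) - ?R (?y n) n) *
      (2 powr (a - 1) * (- (real (?m n) powr (1 - (2 * a - 1)) * negbin (2 * a - 1) (?m n)))
      * (?N powr (1 - (2 - a)) * negbin (2 - a) n))
      \<le> real (?m n) powr (1 - a) * wcoeff a a (?y n) (?m n)
          - ?R (?y n) (?m n) * (real (?m n) powr (1 - a) * negbin a (?m n))"
      by (simp only:)
  qed
qed

section \<open>No common positive root of the two equations\<close>

lemma wright_equations_incompatible:
  assumes "0 < x"
    and eta: "x * (1 - wright (- x) (- a) 1)
      = wright (- x) (- a) (1 - a) * (Gamma (1 - a) / Gamma (1 + a))"
    and xi: "x * (1 - wright (- x) (- a) 1) = x * wright (- x) (- a) 1 + wright (- x) (- a) (1 + a)"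
  shows False
proof -
  define W where "W = (\<lambda>\<beta> z. wright (- z) (- a) \<beta>)"
  define D where "D = (\<lambda>z. W a z - W (1 - a) z / rGamma (1 - a) * rGamma a)"
  have W_deriv: "(W \<beta> has_real_derivative - W (\<beta> - a) z) (at z)" for \<beta> z
    unfolding W_def by (rule wright_has_derivative)
  have W_nonneg: "0 \<le> W \<beta> z" if "0 \<le> z" "0 \<le> \<beta>" for \<beta> z
    unfolding W_def using that by (rule wright_nonneg)
  have Gamma_1: "Gamma (1 + a) = a * Gamma a"
    using a Gamma_plus1 [of a] nonpos_Ints_nonpos [of a] by (auto simp: add.commute)
  have pos: "0 < rGamma (1 - a)" "0 < rGamma (2 * a)" "0 < rGamma (2 - a)" "0 < Gamma a"
    using a by (simp_all add: rGamma_inverse_Gamma Gamma_real_pos)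
  define C where "C = 2 powr (a - 1) * (- rGamma (2 * a - 1)) * rGamma (2 - a)"
  \<comment> \<open>Since \<open>2 a - 1 < 0 < 2 a\<close>, this makes
    \<open>rGamma (2 * a - 1)\<close> negative and \<open>C\<close> positive.\<close>
  have "rGamma (2 * a - 1) = (2 * a - 1) * rGamma (2 * a)"
    using rGamma_plus1 [of "2 * a - 1"] by simp
  then have "0 < C"
    unfolding C_def using a pos by (intro mult_pos_pos) (auto simp: mult_neg_pos)
  have gap: "(W (1 - a) z - W (1 - a) (2 powr a * z)) / rGamma (1 - a) * C \<le> D z" if "0 \<le> z" for z
    using wright_gap [OF that] by (simp add: D_def W_def C_def diff_divide_distrib)
  have decr: "W (1 - a) z' \<le> W (1 - a) z" if "0 \<le> z" "z \<le> z'" for z z'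
  proof (rule DERIV_nonpos_imp_nonincreasing [OF that(2)])
    fix u assume "z \<le> u"
    then have "- W (1 - a - a) u \<le> 0"
      using W_nonneg [of u "1 - a - a"] that a by simp
    then show "\<exists>y. (W (1 - a) has_real_derivative y) (at u) \<and> y \<le> 0"
      using W_deriv by blast
  qed
  have scale: "1 < 2 powr a"
    using a by simp
  have D_nonneg: "0 \<le> D z" if "0 \<le> z" for z
  proof -
    have "0 \<le> (W (1 - a) z - W (1 - a) (2 powr a * z)) / rGamma (1 - a) * C"
      using decr [OF that, of "2 powr a * z"] scale that pos \<open>0 < C\<close>
      by (simp add: mult_le_cancel_right1)
    with gap [OF that] show ?thesis by simp
  qed
  \<comment> \<open>Both equations enter here: \<open>xi\<close> with the recurrence gives
    \<open>W a x = a x (1 - W 1 x)\<close>, and \<open>eta\<close> rewrites this through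
    \<open>W (1 - a) x\<close>.\<close>
  have D_x: "D x = 0"
  proof -
    have "W a x = a * (x * (1 - W 1 x))"
      unfolding W_def wright_recurrence xi ..
    also have "\<dots> = a * (W (1 - a) x * (Gamma (1 - a) / (a * Gamma a)))"
      unfolding W_def eta Gamma_1 ..
    also have "\<dots> = W (1 - a) x / rGamma (1 - a) * rGamma a"
      using a Gamma_eq_zero_iff [of a] Gamma_eq_zero_iff [of "1 - a"]
      unfolding rGamma_inverse_Gamma by (simp add: field_simps)
    finally show ?thesis
      by (simp add: D_def)
  qed
  have "W (1 - a) (2 powr a * x) \<le> W (1 - a) x"
    using decr [of x "2 powr a * x"] scale assms(1) by simp
  moreover have "(W (1 - a) x - W (1 - a) (2 powr a * x)) / rGamma (1 - a) * C \<le> 0"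
    using gap [of x] D_x assms(1) by simp
  then have "W (1 - a) x - W (1 - a) (2 powr a * x) \<le> 0"
    using pos \<open>0 < C\<close> by (simp add: mult_le_0_iff divide_le_0_iff)
  ultimately have flat: "W (1 - a) x = W (1 - a) (2 powr a * x)"
    by simp
  \<comment> \<open>Flatness of \<open>W (1 - a)\<close> to the right of \<open>x\<close> kills its
    derivative there, which is the second term of the derivative of \<open>D\<close>.\<close>
  have "- W (1 - a - a) x = 0"
  proof (rule has_derivative_zero_if_flat [OF _ flat W_deriv])
    show "x < 2 powr a * x"
      using scale assms(1) by simp
    show "- W (1 - a - a) z \<le> 0" if "x \<le> z" for z
      using W_nonneg [of z "1 - a - a"] that a assms(1) by simp
  qed
  then have H: "W (1 - a - a) x = 0" by simp
  have "W a = (\<lambda>z. a * (z * W 1 z + W (1 + a) z))"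
    by (simp add: fun_eq_iff W_def wright_recurrence)
  moreover have "((\<lambda>z. a * (z * W 1 z + W (1 + a) z)) has_real_derivative
      a * ((1 * W 1 x + - W (1 - a) x * x) + - W (1 + a - a) x)) (at x)"
    by (intro DERIV_cmult DERIV_add DERIV_mult W_deriv DERIV_ident)
  ultimately have "(W a has_real_derivative - (a * x * W (1 - a) x)) (at x)"
    by (simp add: algebra_simps)
  moreover have "((\<lambda>z. W (1 - a) z / rGamma (1 - a) * rGamma a) has_real_derivative
      - W (1 - a - a) x / rGamma (1 - a) * rGamma a) (at x)"
    by (intro DERIV_cmult_right DERIV_cdivide W_deriv)
  ultimately have "(D has_real_derivative - (a * x * W (1 - a) x)) (at x)"
    unfolding D_def H by (auto dest: DERIV_diff)
  \<comment> \<open>Radius \<open>x\<close> keeps \<open>z\<close> positive, where \<open>D\<close>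
    is known to be nonnegative.\<close>
  moreover have "\<forall>z. \<bar>x - z\<bar> < x \<longrightarrow> D x \<le> D z"
    using D_x D_nonneg by auto
  ultimately have "- (a * x * W (1 - a) x) = 0"
    using assms(1) DERIV_local_min by blast
  then have "W (1 - a) x = 0"
    using a assms(1) by simp
  \<comment> \<open>With \<open>W (1 - a) x = 0\<close>, \<open>eta\<close> leaves
    \<open>W 1 x = 1\<close>, which is also the value \<open>rGamma 1\<close> at 0.\<close>
  then have "W 1 0 = W 1 x"
    using eta assms(1) by (simp add: W_def wright_0)
  from has_derivative_zero_if_flat [OF assms(1) this W_deriv]
  have "W (1 - a) 0 = 0"
    using W_nonneg a by simp
  then show False
    using pos by (simp add: W_def wright_0)
qed

end

theorem theorem1:
  fixes \<alpha> T \<eta> \<xi> :: real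
  assumes "0 < \<alpha>" and "\<alpha> < 1" and "0 < T"
    and "0 < \<eta>" and "eta_equation \<alpha> \<eta>"
    and "\<And>x. 0 < x \<Longrightarrow> eta_equation \<alpha> x \<Longrightarrow> x = \<eta>"
    and "0 < \<xi>" and "xi_equation \<alpha> \<xi>"
    and "\<And>x. 0 < x \<Longrightarrow> xi_equation \<alpha> x \<Longrightarrow> x = \<xi>"
    and "solves_P1 \<alpha> T (temperature \<alpha> \<eta>) (front \<alpha> \<eta>)"
    and "solves_P2 \<alpha> T (temperature \<alpha> \<xi>) (front \<alpha> \<xi>)"
  shows "\<not> same_solution T (temperature \<alpha> \<eta>, front \<alpha> \<eta>) (temperature \<alpha> \<xi>, front \<alpha> \<xi>)"
proof
  assume "same_solution T (temperature \<alpha> \<eta>, front \<alpha> \<eta>) (temperature \<alpha> \<xi>, front \<alpha> \<xi>)"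
  \<comment> \<open>One time suffices: \<open>T powr (\<alpha> / 2)\<close> is positive, so the
    front at \<open>T\<close> determines its constant.\<close>
  then have "front \<alpha> \<eta> T = front \<alpha> \<xi> T"
    using assms(3) by (simp add: same_solution_def)
  then have "\<eta> = \<xi>"
    using assms(3) by (simp add: front_def)
  then show False
    using wright_equations_incompatible [of "\<alpha> / 2" "2 * \<eta>"] assms(1,2,4,5,8)
    by (simp add: eta_equation_def xi_equation_def mainardi_def)
qed

end
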